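(* Let $\mathcal{U}=\{\pmb{c}^1,\ldots,\pmb{c}^N\}\subseteq\mathbb{R}^n_+$ and let $K\ge 1$ be an integer. Then there is an optimal solution $(t,\lambda,\mu)$ to the problem $$\begin{aligned}\max\ & t\\ \text{s.t. } & t c^i_j\le\sum_{k\in[K]}\sum_{\ell\in[N]}\mu_{ik}\lambda_{k\ell}c^\ell_j && \forall i\in[N],\,j\in[n]\\ & \sum_{i\in[N]}\lambda_{ki}=1 && \forall k\in[K]\\ & \sum_{k\in[K]}\mu_{ik}=1 && \forall i\in[N]\\ & t\ge 0\\ & \lambda_{ki}\ge 0 && \forall k\in[K],\,i\in[N]\\ & \mu_{ik}\ge 0 && \forall i\in[N],\,k\in[K]\end{aligned}$$ that gives an approximation guarantee of at most $\lceil N/K\rceil$.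
   Context: $[m]=\{1,\ldots,m\}$ for a positive integer $m$; $\mathbb{R}^n_+$ is the set of vectors in $\mathbb{R}^n$ with nonnegative entries; $c^i_j$ is the $j$-th entry of the scenario $\pmb{c}^i$. A feasible solution $(t,\lambda,\mu)$ defines the reduced scenario set $\mathcal{C}=\{\hat{\pmb{c}}^1,\ldots,\hat{\pmb{c}}^K\}$ with $\hat{c}^k_j=\sum_{i\in[N]}\lambda_{ki}c^i_j$, and the approximation guarantee it gives is $1/t$: for any set of feasible solutions $\mathcal{X}\subseteq\mathbb{R}^n_+$, an optimal solution of the robust problem $\min_{\pmb{x}\in\mathcal{X}}\max_{\pmb{c}\in\mathcal{C}}\pmb{c}^\intercal\pmb{x}$ is a $1/t$-approximation for the robust problem $\min_{\pmb{x}\in\mathcal{X}}\max_{\pmb{c}\in\mathcal{U}}\pmb{c}^\intercal\pmb{x}$, i.e., its objective value in the latter problem is at most $1/t$ times the optimal value of the latter problem.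
   Formalization: The set U is assumed to contain a nonzero scenario (U is not {0}); if all scenarios are zero, every t ≥ 0 is feasible, the problem is unbounded and has no optimal solution. *)

theory Defs
  imports "HOL-Analysis.Analysis"
begin

definition nonneg_orthant :: "(real ^ 'n) set" where
  "nonneg_orthant = {x. \<forall>j. 0 \<le> x $ j}"

definition feasible_sol ::
  "nat \<Rightarrow> nat \<Rightarrow> (nat \<Rightarrow> real ^ 'n) \<Rightarrow> real \<Rightarrow> (nat \<Rightarrow> nat \<Rightarrow> real) \<Rightarrow> (nat \<Rightarrow> nat \<Rightarrow> real) \<Rightarrow> bool"
where
  "feasible_sol N K c t lam mu \<longleftrightarrow>
     (\<forall>i\<in>{1..N}. \<forall>j. t * c i $ j \<le> (\<Sum>k=1..K. \<Sum>l=1..N. mu i k * lam k l * c l $ j)) \<and>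
     (\<forall>k\<in>{1..K}. (\<Sum>i=1..N. lam k i) = 1) \<and>
     (\<forall>i\<in>{1..N}. (\<Sum>k=1..K. mu i k) = 1) \<and>
     0 \<le> t \<and>
     (\<forall>k\<in>{1..K}. \<forall>i\<in>{1..N}. 0 \<le> lam k i) \<and>
     (\<forall>i\<in>{1..N}. \<forall>k\<in>{1..K}. 0 \<le> mu i k)"

definition optimal_sol ::
  "nat \<Rightarrow> nat \<Rightarrow> (nat \<Rightarrow> real ^ 'n) \<Rightarrow> real \<Rightarrow> (nat \<Rightarrow> nat \<Rightarrow> real) \<Rightarrow> (nat \<Rightarrow> nat \<Rightarrow> real) \<Rightarrow> bool"
where
  "optimal_sol N K c t lam mu \<longleftrightarrow>
     feasible_sol N K c t lam mu \<and>
     (\<forall>t' lam' mu'. feasible_sol N K c t' lam' mu' \<longrightarrow> t' \<le> t)"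

definition reduced_scenarios ::
  "nat \<Rightarrow> nat \<Rightarrow> (nat \<Rightarrow> real ^ 'n) \<Rightarrow> (nat \<Rightarrow> nat \<Rightarrow> real) \<Rightarrow> (real ^ 'n) set"
where
  "reduced_scenarios N K c lam = (\<lambda>k. \<chi> j. \<Sum>i=1..N. lam k i * c i $ j) ` {1..K}"

text \<open>\<open>Max\<close> is meaningful here only for finite nonempty scenario sets.\<close>

definition robust_cost :: "(real ^ 'n) set \<Rightarrow> real ^ 'n \<Rightarrow> real" where
  "robust_cost C x = Max ((\<lambda>c. c \<bullet> x) ` C)"

definition robust_optimal :: "(real ^ 'n) set \<Rightarrow> (real ^ 'n) set \<Rightarrow> real ^ 'n \<Rightarrow> bool" where
  "robust_optimal C X x \<longleftrightarrow> is_arg_min (robust_cost C) (\<lambda>y. y \<in> X) x"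

text \<open>The optimal value is an infimum, as the minimum over an arbitrary \<open>X\<close> need not be
  attained. For scenarios and solutions in the nonnegative orthant the costs are bounded
  below by 0, so the infimum is a genuine one.\<close>

definition robust_approx ::
  "real \<Rightarrow> (real ^ 'n) set \<Rightarrow> (real ^ 'n) set \<Rightarrow> real ^ 'n \<Rightarrow> bool"
where
  "robust_approx \<alpha> U X x \<longleftrightarrow>
     x \<in> X \<and> robust_cost U x \<le> \<alpha> * (INF y\<in>X. robust_cost U y)"

definition approx_guarantee :: "real \<Rightarrow> (real ^ 'n) set \<Rightarrow> (real ^ 'n) set \<Rightarrow> bool" where
  "approx_guarantee \<alpha> U C \<longleftrightarrow>
     (\<forall>X x. X \<subseteq> nonneg_orthant \<longrightarrow> robust_optimal C X x \<longrightarrow> robust_approx \<alpha> U X x)"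

end

theory Submission
  imports Defs
begin

text \<open>
  Every \<open>feasible_sol\<close> with \<open>t > 0\<close> already gives the guarantee \<open>1 / t\<close>
  (\<open>feasible_sol_approx_guarantee\<close>): for a nonnegative solution \<open>x\<close>, the first constraint says
  that \<open>t\<close> times the cost of \<open>x\<close> in a scenario is at most a weighted average of its costs in the
  reduced scenarios, while each reduced scenario is itself an average of original ones.
  Hence \<open>t * robust_cost U x \<le> robust_cost C x \<le> robust_cost U x\<close>, and a minimizer of the middle
  term loses at most the factor \<open>1 / t\<close>.

  So only the optimal value of \<open>t\<close> matters, and it suffices to exhibit one feasible solution with
  \<open>t = 1 / m\<close>, where \<open>m = \<lceil>N / K\<rceil>\<close> (\<open>round_robin_feasible\<close>): split the scenarios into \<open>K\<close> groups
  of at most \<open>m\<close> members and let each reduced scenario be an average of \<open>m\<close> entries that lists a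
  whole group. By nonnegativity, the average dominates each member divided by \<open>m\<close>.

  The maximum is attained (\<open>optimal_sol_exists\<close>) because the feasible set is compact once
  the weights outside the index ranges are fixed. Its only direction that could be unbounded is
  \<open>t\<close>, and a nonzero scenario rules this out: a coordinate in which some scenario is positive has a
  largest entry, and an average of the entries cannot exceed it, so \<open>t \<le> 1\<close>.
\<close>

section \<open>Averages\<close>

lemma weighted_average_le:
  fixes w a :: "'i \<Rightarrow> real"
  assumes "\<And>i. i \<in> I \<Longrightarrow> 0 \<le> w i" and "sum w I = 1" and "\<And>i. i \<in> I \<Longrightarrow> a i \<le> M"
  shows "(\<Sum>i\<in>I. w i * a i) \<le> M"
proof -
  have "(\<Sum>i\<in>I. w i * a i) \<le> (\<Sum>i\<in>I. w i * M)"
    by (intro sum_mono mult_left_mono assms)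
  also have "\<dots> = M"
    using assms(2) by (simp flip: sum_distrib_right)
  finally show ?thesis .
qed

lemma weight_le_1:
  fixes w :: "'i \<Rightarrow> real"
  assumes "finite I" and "\<And>i. i \<in> I \<Longrightarrow> 0 \<le> w i" and "sum w I = 1" and "i \<in> I"
  shows "w i \<le> 1"
  using member_le_sum[of i I w] assms by auto

lemma sum_mult_nested:
  fixes u :: "'k \<Rightarrow> real"
  shows "(\<Sum>k\<in>A. \<Sum>l\<in>B. u k * w k l * v l) = (\<Sum>k\<in>A. u k * (\<Sum>l\<in>B. w k l * v l))"
  by (simp add: sum_distrib_left mult.assoc)

section \<open>The guarantee given by a feasible solution\<close>

lemma reduced_scenarios_altdef:
  "reduced_scenarios N K c lam = (\<lambda>k. \<Sum>i=1..N. lam k i *\<^sub>R c i) ` {1..K}"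
  unfolding reduced_scenarios_def by (intro image_cong refl) (simp add: vec_eq_iff)

lemma robust_cost_ge:
  assumes "finite C" and "v \<in> C"
  shows "v \<bullet> x \<le> robust_cost C x"
  unfolding robust_cost_def using assms by (intro Max_ge) auto

lemma robust_cost_le_iff:
  assumes "finite C" and "C \<noteq> {}"
  shows "robust_cost C x \<le> M \<longleftrightarrow> (\<forall>v\<in>C. v \<bullet> x \<le> M)"
  unfolding robust_cost_def using assms by (subst Max_le_iff) auto

lemma robust_cost_reduced_le:
  fixes c :: "nat \<Rightarrow> real ^ 'n"
  assumes "feasible_sol N K c t lam mu" and "1 \<le> K"
  shows "robust_cost (reduced_scenarios N K c lam) x \<le> robust_cost (c ` {1..N}) x"
proof -
  have "(\<Sum>i=1..N. lam k i *\<^sub>R c i) \<bullet> x \<le> robust_cost (c ` {1..N}) x" if "k \<in> {1..K}" for k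
  proof -
    have "(\<Sum>i=1..N. lam k i * (c i \<bullet> x)) \<le> robust_cost (c ` {1..N}) x"
      using assms(1) that unfolding feasible_sol_def
      by (intro weighted_average_le) (auto intro: robust_cost_ge)
    then show ?thesis
      by (simp add: inner_sum_left)
  qed
  then show ?thesis
    using assms(2) by (subst robust_cost_le_iff) (auto simp: reduced_scenarios_altdef)
qed

lemma robust_cost_le_reduced:
  fixes c :: "nat \<Rightarrow> real ^ 'n"
  assumes feas: "feasible_sol N K c t lam mu" and "0 < t" and "1 \<le> N" and x: "x \<in> nonneg_orthant"
  shows "robust_cost (c ` {1..N}) x \<le> 1 / t * robust_cost (reduced_scenarios N K c lam) x"
proof -
  let ?r = "\<lambda>k. \<Sum>l=1..N. lam k l *\<^sub>R c l"
  let ?C = "reduced_scenarios N K c lam"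
  have "c i \<bullet> x \<le> 1 / t * robust_cost ?C x" if i: "i \<in> {1..N}" for i
  proof -
    have coord: "t * c i $ j \<le> (\<Sum>k=1..K. mu i k *\<^sub>R ?r k) $ j" for j
      using feas i unfolding feasible_sol_def by (simp add: sum_mult_nested)
    have "t * (c i \<bullet> x) = (t *\<^sub>R c i) \<bullet> x"
      by simp
    also have "\<dots> \<le> (\<Sum>k=1..K. mu i k *\<^sub>R ?r k) \<bullet> x"
      unfolding inner_vec_def using x coord
      by (intro sum_mono) (auto simp: nonneg_orthant_def intro!: mult_right_mono)
    also have "\<dots> = (\<Sum>k=1..K. mu i k * (?r k \<bullet> x))"
      by (simp add: inner_sum_left)
    also have "\<dots> \<le> robust_cost ?C x"
      using feas i unfolding feasible_sol_def
      by (intro weighted_average_le) (auto simp: reduced_scenarios_altdef intro!: robust_cost_ge)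
    finally show ?thesis
      using \<open>0 < t\<close> by (simp add: field_simps)
  qed
  then show ?thesis
    using \<open>1 \<le> N\<close> by (subst robust_cost_le_iff) auto
qed

lemma feasible_sol_approx_guarantee:
  fixes c :: "nat \<Rightarrow> real ^ 'n"
  assumes feas: "feasible_sol N K c t lam mu" and "0 < t" and "1 \<le> N" and "1 \<le> K"
  shows "approx_guarantee (1 / t) (c ` {1..N}) (reduced_scenarios N K c lam)"
  unfolding approx_guarantee_def
proof (intro allI impI)
  fix X :: "(real ^ 'n) set" and x
  let ?U = "c ` {1..N}" and ?C = "reduced_scenarios N K c lam"
  assume X: "X \<subseteq> nonneg_orthant" and "robust_optimal ?C X x"
  then have "x \<in> X" and min: "\<And>y. y \<in> X \<Longrightarrow> robust_cost ?C x \<le> robust_cost ?C y"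
    unfolding robust_optimal_def is_arg_min_linorder by auto
  have "t * robust_cost ?U x \<le> robust_cost ?U y" if "y \<in> X" for y
  proof -
    have "t * robust_cost ?U x \<le> robust_cost ?C x"
      using robust_cost_le_reduced[OF feas \<open>0 < t\<close> \<open>1 \<le> N\<close>, of x] X \<open>x \<in> X\<close> \<open>0 < t\<close>
      by (auto simp: field_simps)
    also have "\<dots> \<le> robust_cost ?C y"
      by (rule min) fact
    also have "\<dots> \<le> robust_cost ?U y"
      by (rule robust_cost_reduced_le[OF feas \<open>1 \<le> K\<close>])
    finally show ?thesis .
  qed
  then have "t * robust_cost ?U x \<le> (INF y\<in>X. robust_cost ?U y)"
    using \<open>x \<in> X\<close> by (intro cINF_greatest) auto
  then show "robust_approx (1 / t) ?U X x"
    unfolding robust_approx_def using \<open>x \<in> X\<close> \<open>0 < t\<close> by (simp add: field_simps)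
qed

section \<open>Existence of an optimal solution\<close>

text \<open>Evaluating the first constraint at a largest entry of a coordinate gives the bound.\<close>

lemma feasible_sol_le_1:
  fixes c :: "nat \<Rightarrow> real ^ 'n"
  assumes feas: "feasible_sol N K c t lam mu" and i: "i \<in> {1..N}" and pos: "0 < c i $ j"
  shows "t \<le> 1"
proof -
  define M where "M = Max ((\<lambda>l. c l $ j) ` {1..N})"
  have le: "c l $ j \<le> M" if "l \<in> {1..N}" for l
    unfolding M_def using that by (intro Max_ge) auto
  have "M \<in> (\<lambda>l. c l $ j) ` {1..N}"
    unfolding M_def using i by (intro Max_in) auto
  then obtain p where p: "p \<in> {1..N}" "c p $ j = M"
    by auto
  have "0 < M"
    using le[OF i] pos by simp
  have "t * M \<le> (\<Sum>k=1..K. mu p k * (\<Sum>l=1..N. lam k l * c l $ j))"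
    using feas p unfolding feasible_sol_def sum_mult_nested by force
  also have "\<dots> \<le> M"
    using feas p(1) le unfolding feasible_sol_def by (intro weighted_average_le) auto
  finally show ?thesis
    using \<open>0 < M\<close> by simp
qed

lemma compact_all_mem:
  fixes S :: "'b :: topological_space set"
  assumes "compact S"
  shows "compact {f :: 'a \<Rightarrow> 'b. \<forall>i. f i \<in> S}"
proof -
  have "compactin (product_topology (\<lambda>_. euclidean) (UNIV :: 'a set)) (PiE UNIV (\<lambda>_. S))"
    using assms by (simp add: compactin_PiE)
  also have "PiE UNIV (\<lambda>_. S) = {f :: 'a \<Rightarrow> 'b. \<forall>i. f i \<in> S}"
    by (auto simp: PiE_UNIV_domain)
  finally show ?thesis
    by (simp add: euclidean_product_topology)
qed

lemma closed_feasible_sol: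
  fixes c :: "nat \<Rightarrow> real ^ 'n"
  shows "closed {(t, lam, mu). feasible_sol N K c t lam mu}"
proof -
  let ?E = "UNIV :: (real \<times> (nat \<Rightarrow> nat \<Rightarrow> real) \<times> (nat \<Rightarrow> nat \<Rightarrow> real)) set"
  have t: "continuous_on ?E fst" and lam: "continuous_on ?E (\<lambda>x. fst (snd x))"
    and mu: "continuous_on ?E (\<lambda>x. snd (snd x))"
    by (intro continuous_on_fst continuous_on_snd continuous_on_id)+
  note entry = continuous_on_product_then_coordinatewise[OF continuous_on_product_then_coordinatewise]
  show ?thesis
    unfolding feasible_sol_def Ball_def case_prod_beta
    by (intro closed_Collect_conj closed_Collect_all closed_Collect_imp open_Collect_const
          closed_Collect_le closed_Collect_eq continuous_on_sum continuous_on_mult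
          continuous_on_const t entry[OF lam] entry[OF mu])
qed

text \<open>Only the entries in the index ranges of the linear program are constrained. Setting the
  others to 0 confines all weights to \<open>[0, 1]\<close>, so that compactness applies to weight matrices
  with infinitely many entries.\<close>

lemma feasible_sol_zero_extension:
  fixes c :: "nat \<Rightarrow> real ^ 'n"
  assumes feas: "feasible_sol N K c t lam mu"
  obtains lam' mu' where "feasible_sol N K c t lam' mu'"
    and "\<And>k l. lam' k l \<in> {0..1}" and "\<And>i k. mu' i k \<in> {0..1}"
proof
  let ?lam = "\<lambda>k l. if k \<in> {1..K} \<and> l \<in> {1..N} then lam k l else 0"
  let ?mu = "\<lambda>i k. if i \<in> {1..N} \<and> k \<in> {1..K} then mu i k else 0"
  show "feasible_sol N K c t ?lam ?mu"
    using feas unfolding feasible_sol_def by simp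
  show "?lam k l \<in> {0..1}" for k l
    using feas weight_le_1[of "{1..N}" "lam k" l] unfolding feasible_sol_def by auto
  show "?mu i k \<in> {0..1}" for i k
    using feas weight_le_1[of "{1..K}" "mu i" k] unfolding feasible_sol_def by auto
qed

lemma optimal_sol_exists:
  fixes c :: "nat \<Rightarrow> real ^ 'n"
  assumes feas0: "feasible_sol N K c t0 lam0 mu0" and pos: "i \<in> {1..N}" "0 < c i $ j"
  obtains t lam mu where "optimal_sol N K c t lam mu"
proof -
  define W where "W = {w :: nat \<Rightarrow> nat \<Rightarrow> real. \<forall>k. w k \<in> {f. \<forall>l. f l \<in> {0..1}}}"
  define S where
    "S = ({0..1} \<times> W \<times> W) \<inter> {(t, lam, mu). feasible_sol N K c t lam mu}"
  have "compact W"
    unfolding W_def by (intro compact_all_mem compact_Icc)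
  then have "compact S"
    unfolding S_def by (intro compact_Int_closed compact_Times compact_Icc closed_feasible_sol)
  have in_S: "\<exists>lam' mu'. (t, lam', mu') \<in> S" if feas: "feasible_sol N K c t lam mu" for t lam mu
  proof -
    have "t \<in> {0..1}"
      using feasible_sol_le_1[OF feas pos] feas by (simp add: feasible_sol_def)
    moreover obtain lam' mu' where "feasible_sol N K c t lam' mu'" "lam' \<in> W" "mu' \<in> W"
      unfolding W_def using feasible_sol_zero_extension[OF feas] by simp metis
    ultimately show ?thesis
      unfolding S_def by blast
  qed
  have "S \<noteq> {}"
    using in_S[OF feas0] by auto
  then obtain s where "s \<in> S" and max: "\<forall>y\<in>S. fst y \<le> fst s"
    using continuous_attains_sup[OF \<open>compact S\<close> _ continuous_on_fst[OF continuous_on_id]] by blast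
  obtain t lam mu where s: "s = (t, lam, mu)"
    by (cases s)
  have "feasible_sol N K c t lam mu"
    using \<open>s \<in> S\<close> by (simp add: s S_def)
  moreover have "t' \<le> t" if feas': "feasible_sol N K c t' lam' mu'" for t' lam' mu'
    using in_S[OF feas'] max by (auto simp only: s fst_conv dest!: bspec)
  ultimately have "optimal_sol N K c t lam mu"
    unfolding optimal_sol_def by blast
  then show thesis
    by (rule that)
qed

section \<open>A feasible solution of value \<open>1 / \<lceil>N / K\<rceil>\<close>\<close>

text \<open>The \<open>k\<close>-th group is \<open>k, k + K, k + 2 * K, \<dots>\<close>, so \<open>m\<close> entries per group reach all scenarios
  as soon as \<open>N \<le> m * K\<close>. Entries beyond \<open>N\<close> are replaced by \<open>N\<close>; such repetitions, and groups
  that overlap because of them, do no harm, as an average of \<open>m\<close> nonnegative entries still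
  dominates each of them divided by \<open>m\<close>.\<close>

lemma round_robin_feasible:
  fixes c :: "nat \<Rightarrow> real ^ 'n"
  assumes "1 \<le> N" and "1 \<le> K" and "1 \<le> m" and "N \<le> m * K"
    and nonneg: "c ` {1..N} \<subseteq> nonneg_orthant"
  obtains lam mu where "feasible_sol N K c (1 / real m) lam mu"
proof
  define h where "h k s = min N (k + s * K)" for k s
  \<comment> \<open>Scenario \<open>i\<close> is entry \<open>(i - 1) div K\<close> of group \<open>g i\<close>.\<close>
  define g where "g i = (i - 1) mod K + 1" for i
  define lam :: "nat \<Rightarrow> nat \<Rightarrow> real"
    where "lam k l = (\<Sum>s<m. if l = h k s then 1 / real m else 0)" for k l
  define mu :: "nat \<Rightarrow> nat \<Rightarrow> real" where "mu i k = (if k = g i then 1 else 0)" for i k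
  have h_range: "h k s \<in> {1..N}" if "k \<in> {1..K}" for k s
    using that \<open>1 \<le> N\<close> by (auto simp: h_def)
  have g_range: "g i \<in> {1..K}" for i
    using \<open>1 \<le> K\<close> by (auto simp: g_def Suc_le_eq)
  have average: "(\<Sum>l=1..N. lam k l * v l) = (\<Sum>s<m. v (h k s) / real m)"
    if "k \<in> {1..K}" for k and v :: "nat \<Rightarrow> real"
  proof -
    have "(\<Sum>l=1..N. lam k l * v l) = (\<Sum>s<m. \<Sum>l=1..N. if l = h k s then v l / real m else 0)"
      unfolding lam_def sum_distrib_right
      by (subst sum.swap) (intro sum.cong refl, simp)
    also have "\<dots> = (\<Sum>s<m. v (h k s) / real m)"
      using h_range[OF that] by (intro sum.cong refl) (simp add: sum.delta)
    finally show ?thesis .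
  qed
  have dominates: "1 / real m * c i $ j \<le> (\<Sum>l=1..N. lam (g i) l * c l $ j)"
    if i: "i \<in> {1..N}" for i j
  proof -
    let ?s = "(i - 1) div K"
    have "?s < m"
      using i \<open>N \<le> m * K\<close> \<open>1 \<le> K\<close> by (intro less_mult_imp_div_less) auto
    have "g i + ?s * K = i"
      using i mod_div_mult_eq[of "i - 1" K] by (simp add: g_def)
    then have "h (g i) ?s = i"
      using i by (simp add: h_def)
    then have "1 / real m * c i $ j = c (h (g i) ?s) $ j / real m"
      by simp
    also have "\<dots> \<le> (\<Sum>s<m. c (h (g i) s) $ j / real m)"
      using nonneg h_range[OF g_range] \<open>?s < m\<close>
      by (intro member_le_sum[where f = "\<lambda>s. c (h (g i) s) $ j / real m"])
         (auto simp: nonneg_orthant_def image_subset_iff)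
    also have "\<dots> = (\<Sum>l=1..N. lam (g i) l * c l $ j)"
      by (rule average[OF g_range, symmetric])
    finally show ?thesis .
  qed
  have lam_sum: "(\<Sum>l=1..N. lam k l) = 1" if "k \<in> {1..K}" for k
    using average[OF that, of "\<lambda>_. 1"] \<open>1 \<le> m\<close> by simp
  have mu_sum: "(\<Sum>k=1..K. mu i k * w k) = w (g i)" for i and w :: "nat \<Rightarrow> real"
  proof -
    have "(\<Sum>k=1..K. mu i k * w k) = (\<Sum>k=1..K. if k = g i then w k else 0)"
      by (intro sum.cong refl) (simp add: mu_def)
    also have "\<dots> = w (g i)"
      using g_range by (simp add: sum.delta)
    finally show ?thesis .
  qed
  have "(\<Sum>k=1..K. mu i k) = 1" for i
    using mu_sum[of i "\<lambda>_. 1"] by simp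
  moreover have "0 \<le> lam k l" "0 \<le> mu i k" for i k l
    unfolding lam_def mu_def by (auto intro!: sum_nonneg)
  ultimately show "feasible_sol N K c (1 / real m) lam mu"
    unfolding feasible_sol_def sum_mult_nested mu_sum using dominates lam_sum by auto
qed

theorem corollary7:
  fixes c :: "nat \<Rightarrow> real ^ 'n" and U :: "(real ^ 'n) set" and N K :: nat
  assumes "N \<ge> 1" and "U = c ` {1..N}" and "U \<subseteq> nonneg_orthant"
    and "U \<noteq> {0}"
    and "K \<ge> 1"
  shows "\<exists>t lam mu. optimal_sol N K c t lam mu \<and>
           t > 0 \<and> 1 / t \<le> of_int \<lceil>real N / real K\<rceil> \<and>
           approx_guarantee (1 / t) U (reduced_scenarios N K c lam)"
proof -
  define m where "m = nat \<lceil>real N / real K\<rceil>"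
  have "0 < real N / real K"
    using assms(1,5) by simp
  then have m: "1 \<le> m" "real m = of_int \<lceil>real N / real K\<rceil>"
    unfolding m_def by linarith+
  have "real N / real K \<le> real m"
    unfolding m(2) by (rule le_of_int_ceiling)
  then have "real N \<le> real (m * K)"
    using assms(5) by (simp add: field_simps)
  then have "N \<le> m * K"
    by (simp only: of_nat_le_iff)
  then obtain lam0 mu0 where feas0: "feasible_sol N K c (1 / real m) lam0 mu0"
    using round_robin_feasible[of N K m c] assms m(1) by metis
  have "U \<noteq> {}"
    using assms(1,2) by auto
  then obtain v where "v \<in> U" "v \<noteq> 0"
    using \<open>U \<noteq> {0}\<close> by blast
  then obtain i j where i: "i \<in> {1..N}" and "c i $ j \<noteq> 0"
    using assms(2) by (auto simp: vec_eq_iff)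
  then have "0 < c i $ j"
    using assms(2,3) by (force simp: nonneg_orthant_def order.strict_iff_order)
  then obtain t lam mu where opt: "optimal_sol N K c t lam mu"
    using optimal_sol_exists[OF feas0 i] by blast
  then have t: "1 / real m \<le> t"
    using feas0 unfolding optimal_sol_def by blast
  then have "0 < t"
    using m(1) by (simp add: order.strict_trans2[OF _ t])
  moreover have "1 / t \<le> of_int \<lceil>real N / real K\<rceil>"
    using t \<open>0 < t\<close> m(1) unfolding m(2)[symmetric] by (simp add: field_simps)
  moreover have "approx_guarantee (1 / t) U (reduced_scenarios N K c lam)"
    using opt \<open>0 < t\<close> assms(1,5) unfolding assms(2) optimal_sol_def
    by (intro feasible_sol_approx_guarantee) auto
  ultimately show ?thesis
    using opt by blast
qed

end
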